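(* Let $n,p,q$ be integers with $p,q\ge 1$ and $0\le n\le pq$. The cubical complex $X(n;p,q)$ is a deformation retract of the configuration space $C(n;p,q)$.
   Context: $C(n;p,q)$ is the ordered configuration space of $n$ unit squares in a $p\times q$ rectangle. It is the subspace of $\mathbb{R}^{2n}$ of all points $(x_1,y_1,\dots,x_n,y_n)$ such that $1\le x_k\le p$ and $1\le y_k\le q$ for all $1\le k\le n$, and such that $|x_k-x_\ell|\ge 1$ or $|y_k-y_\ell|\ge 1$ for all $1\le k<\ell\le n$. $G(n;p,q)$ is the space $([1,p]\times[1,q])^n\subset\mathbb{R}^{2n}$ with its standard cubical complex structure: its closed cells are products of $2n$ factors, each of which is either a point $\{i\}$ or an interval $[i,i+1]$ with integer endpoints. $X(n;p,q)$ is the subcomplex of $G(n;p,q)$ consisting of all cells of $G(n;p,q)$ that are fully contained in $C(n;p,q)$. *)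

theory Defs
  imports "HOL-Analysis.Analysis"
begin

text \<open>
  A configuration is a function \<open>c\<close> with \<open>c k = (x\<^sub>k, y\<^sub>k)\<close> for \<open>k \<in> {1..n}\<close>, extensional outside
  \<open>{1..n}\<close>. This keeps \<open>n\<close> an ordinary number (including \<open>n = 0\<close>, where the space is a point).
\<close>

definition conf_ambient :: "nat \<Rightarrow> (nat \<Rightarrow> real \<times> real) topology" where
  "conf_ambient n = product_topology (\<lambda>k. euclidean) {1..n}"

definition conf_set :: "nat \<Rightarrow> nat \<Rightarrow> nat \<Rightarrow> (nat \<Rightarrow> real \<times> real) set" where
  "conf_set n p q =
     {c \<in> topspace (conf_ambient n).
        (\<forall>k\<in>{1..n}. 1 \<le> fst (c k) \<and> fst (c k) \<le> real p \<and>
                    1 \<le> snd (c k) \<and> snd (c k) \<le> real q) \<and>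
        (\<forall>k l. 1 \<le> k \<and> k < l \<and> l \<le> n \<longrightarrow>
           \<bar>fst (c k) - fst (c l)\<bar> \<ge> 1 \<or> \<bar>snd (c k) - snd (c l)\<bar> \<ge> 1)}"

definition conf_space :: "nat \<Rightarrow> nat \<Rightarrow> nat \<Rightarrow> (nat \<Rightarrow> real \<times> real) topology" where
  "conf_space n p q = subtopology (conf_ambient n) (conf_set n p q)"

definition interval_cells :: "nat \<Rightarrow> real set set" where
  "interval_cells p =
     {{real i} | i. 1 \<le> i \<and> i \<le> p} \<union> {{real i..real (i + 1)} | i. 1 \<le> i \<and> i + 1 \<le> p}"

definition grid_set :: "nat \<Rightarrow> nat \<Rightarrow> nat \<Rightarrow> (nat \<Rightarrow> real \<times> real) set" where
  "grid_set n p q = (\<Pi>\<^sub>E k\<in>{1..n}. {1..real p} \<times> {1..real q})"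

definition grid_cells :: "nat \<Rightarrow> nat \<Rightarrow> nat \<Rightarrow> (nat \<Rightarrow> real \<times> real) set set" where
  "grid_cells n p q =
     {(\<Pi>\<^sub>E k\<in>{1..n}. I k \<times> J k) | I J.
        \<forall>k\<in>{1..n}. I k \<in> interval_cells p \<and> J k \<in> interval_cells q}"

definition X_cells :: "nat \<Rightarrow> nat \<Rightarrow> nat \<Rightarrow> (nat \<Rightarrow> real \<times> real) set set" where
  "X_cells n p q = {e \<in> grid_cells n p q. e \<subseteq> conf_set n p q}"

definition X_set :: "nat \<Rightarrow> nat \<Rightarrow> nat \<Rightarrow> (nat \<Rightarrow> real \<times> real) set" where
  "X_set n p q = \<Union> (X_cells n p q)"

text \<open>
  Deformation retracts are taken in the strong sense: every stage of the homotopy from the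
  identity to the retraction fixes \<open>A\<close> pointwise.
\<close>

definition deformation_retract_of_space :: "'a set \<Rightarrow> 'a topology \<Rightarrow> bool"
    (infix \<open>deformation'_retract'_of'_space\<close> 50) where
  "A deformation_retract_of_space T \<longleftrightarrow>
     A \<subseteq> topspace T \<and>
     (\<exists>r. continuous_map T (subtopology T A) r \<and> (\<forall>a\<in>A. r a = a) \<and>
          homotopic_with (\<lambda>f. \<forall>a\<in>A. f a = a) T T id r)"

lemma deformation_retract_of_space_imp_retract_of_space:
  "A deformation_retract_of_space T \<Longrightarrow> A retract_of_space T"
  by (auto simp: deformation_retract_of_space_def retract_of_space_def)

lemma Union_interval_cells: "p \<ge> 1 \<Longrightarrow> \<Union> (interval_cells p) = {1..real p}"
proof
  show "\<Union> (interval_cells p) \<subseteq> {1..real p}"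
    by (auto simp: interval_cells_def)
  assume "p \<ge> 1"
  show "{1..real p} \<subseteq> \<Union> (interval_cells p)"
  proof
    fix x assume x: "x \<in> {1..real p}"
    define i where "i = nat \<lfloor>x\<rfloor>"
    have i: "1 \<le> i" "i \<le> p" "real i \<le> x" "x \<le> real (i + 1)"
      using x unfolding i_def by (auto, linarith+)
    show "x \<in> \<Union> (interval_cells p)"
    proof (cases "i = p")
      case True
      then have "x = real p" using i x by auto
      then show ?thesis using \<open>p \<ge> 1\<close> by (auto simp: interval_cells_def)
    next
      case False
      then have "{real i..real (i + 1)} \<in> interval_cells p"
        using i unfolding interval_cells_def by auto
      then show ?thesis using i by (intro UnionI[of "{real i..real (i + 1)}"]) auto
    qed
  qed
qed

lemma Union_grid_cells:
  assumes "p \<ge> 1" "q \<ge> 1"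
  shows "\<Union> (grid_cells n p q) = grid_set n p q"
proof
  show "\<Union> (grid_cells n p q) \<subseteq> grid_set n p q"
  proof
    fix c assume "c \<in> \<Union> (grid_cells n p q)"
    then obtain I J where IJ: "\<forall>k\<in>{1..n}. I k \<in> interval_cells p \<and> J k \<in> interval_cells q"
      and c: "c \<in> (\<Pi>\<^sub>E k\<in>{1..n}. I k \<times> J k)"
      unfolding grid_cells_def by blast
    have "I k \<times> J k \<subseteq> {1..real p} \<times> {1..real q}" if "k \<in> {1..n}" for k
      using IJ that Union_interval_cells[OF assms(1)] Union_interval_cells[OF assms(2)] by blast
    then have "(\<Pi>\<^sub>E k\<in>{1..n}. I k \<times> J k) \<subseteq> grid_set n p q"
      unfolding grid_set_def by (intro PiE_mono)
    then show "c \<in> grid_set n p q" using c by blast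
  qed
  show "grid_set n p q \<subseteq> \<Union> (grid_cells n p q)"
  proof
    fix c assume c: "c \<in> grid_set n p q"
    have "\<forall>k\<in>{1..n}. \<exists>I J. I \<in> interval_cells p \<and> J \<in> interval_cells q \<and> c k \<in> I \<times> J"
    proof
      fix k assume "k \<in> {1..n}"
      then have "c k \<in> {1..real p} \<times> {1..real q}" using c unfolding grid_set_def by (rule PiE_mem[rotated])
      then show "\<exists>I J. I \<in> interval_cells p \<and> J \<in> interval_cells q \<and> c k \<in> I \<times> J"
        unfolding Union_interval_cells[OF assms(1), symmetric]
          Union_interval_cells[OF assms(2), symmetric] mem_Times_iff by blast
    qed
    then obtain I J where IJ:
      "\<forall>k\<in>{1..n}. I k \<in> interval_cells p \<and> J k \<in> interval_cells q \<and> c k \<in> I k \<times> J k"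
      by metis
    then have "c \<in> (\<Pi>\<^sub>E k\<in>{1..n}. I k \<times> J k)" using c unfolding grid_set_def by (auto simp: PiE_iff)
    moreover have "(\<Pi>\<^sub>E k\<in>{1..n}. I k \<times> J k) \<in> grid_cells n p q"
      using IJ unfolding grid_cells_def by blast
    ultimately show "c \<in> \<Union> (grid_cells n p q)" by blast
  qed
qed

lemma topspace_conf_space: "topspace (conf_space n p q) = conf_set n p q"
  by (auto simp: conf_space_def conf_set_def)

lemma X_set_subset_conf_set: "X_set n p q \<subseteq> conf_set n p q"
  by (auto simp: X_set_def X_cells_def)

end

theory Submission
  imports Defs
begin

text \<open>
  Choose in every interval \<open>[m, m + 1]\<close> an interior point \<open>m + pivot m\<close>, with fractional parts strictly
  decreasing in \<open>m\<close>. Expand every interval about its point by a factor \<open>1 / s\<close>, clamping at the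
  endpoints, and apply this map of the line to all coordinates at once. Since the fractional parts
  decrease, two coordinates at distance at least one stay so, and the configuration space is
  preserved. A configuration lies in the complex iff each pair of squares is separated, in one of the
  two coordinates, by some \<open>[m, m + 1]\<close>; for a given pair this happens as soon as \<open>s\<close> is at most the
  largest of finitely many explicit piecewise linear functions of the configuration. Stopping
  at the minimum of these thresholds over all pairs (which is positive on the configuration
  space and equal to one on the complex) gives the retraction, and its homotopy to the identity.
\<close>

section \<open>Expansion of the line about pivots, and stopping thresholds\<close>

text \<open>The proof needs these values to be positive and strictly decreasing, starting from 1 at
  \<open>m = 0\<close>; they are therefore below 1 for \<open>m \<ge> 1\<close>.\<close>

definition pivot :: "nat \<Rightarrow> real" where
  "pivot m = 1 / (real m + 1)"

definition ramp :: "real \<Rightarrow> nat \<Rightarrow> real \<Rightarrow> real" where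
  "ramp s m x = max 0 (min 1 (pivot m + (x - real m - pivot m) / s))"

text \<open>Each \<open>ramp\<close> is the length of the part of \<open>[m, m + 1]\<close> below
  the image of \<open>x\<close>, and these lengths add up to the position of the image. A sum
  requires no choice of the interval containing \<open>x\<close>, so continuity can be checked term
  by term.\<close>

definition spread :: "nat \<Rightarrow> real \<Rightarrow> real \<Rightarrow> real" where
  "spread p s x = 1 + (\<Sum>m = 1..<p. ramp s m x)"

text \<open>The largest \<open>s \<le> 1\<close> for which the expansion by \<open>1 / s\<close> pushes \<open>a\<close> to or below \<open>m\<close> and \<open>b\<close> to or
  above \<open>m + 1\<close>; if it is not positive, there is no such \<open>s\<close>.\<close>

definition clearance :: "nat \<Rightarrow> real \<Rightarrow> real \<Rightarrow> real" where
  "clearance m a b =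
     min 1 (min ((real m + pivot m - a) / pivot m) ((b - real m - pivot m) / (1 - pivot m)))"

text \<open>The index \<open>p\<close>, beyond the last grid interval, keeps the set nonempty when
  \<open>p = 1\<close>. For coordinates at most \<open>p\<close> its term is negative, so it never
  creates a positive threshold.\<close>

definition axis_slack :: "nat \<Rightarrow> real \<Rightarrow> real \<Rightarrow> real" where
  "axis_slack p a b = Max ((\<lambda>m. max (clearance m a b) (clearance m b a)) ` {1..p})"

definition pair_slack :: "nat \<Rightarrow> nat \<Rightarrow> real \<times> real \<Rightarrow> real \<times> real \<Rightarrow> real" where
  "pair_slack p q u v = max (axis_slack p (fst u) (fst v)) (axis_slack q (snd u) (snd v))"

definition index_pairs :: "nat \<Rightarrow> (nat \<times> nat) set" where
  "index_pairs n = {(k, l) \<in> {1..n} \<times> {1..n}. k < l}"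

text \<open>The inserted 1 is the value when there are no pairs, that is, for
  \<open>n \<le> 1\<close>.\<close>

definition slack :: "nat \<Rightarrow> nat \<Rightarrow> nat \<Rightarrow> (nat \<Rightarrow> real \<times> real) \<Rightarrow> real" where
  "slack n p q c = Min (insert 1 ((\<lambda>(k, l). pair_slack p q (c k) (c l)) ` index_pairs n))"

definition spread_conf :: "nat \<Rightarrow> nat \<Rightarrow> nat \<Rightarrow> real \<Rightarrow> (nat \<Rightarrow> real \<times> real) \<Rightarrow> nat \<Rightarrow> real \<times> real"
  where
  "spread_conf n p q s c = (\<lambda>k\<in>{1..n}. (spread p s (fst (c k)), spread q s (snd (c k))))"

text \<open>Unlike a distance of at least one, this condition passes to all points of the smallest
  grid cells around \<open>a\<close> and \<open>b\<close>.\<close>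

definition grid_separated :: "nat \<Rightarrow> real \<Rightarrow> real \<Rightarrow> bool" where
  "grid_separated p a b \<longleftrightarrow>
     (\<exists>m\<in>{1..<p}. a \<le> real m \<and> real m + 1 \<le> b \<or> b \<le> real m \<and> real m + 1 \<le> a)"

section \<open>The expanded line: range and unit gaps\<close>

lemma pivot_pos: "0 < pivot m"
  and pivot_less_1: "m \<ge> 1 \<Longrightarrow> pivot m < 1"
  and pivot_Suc_less: "pivot (Suc m) < pivot m"
  by (auto simp: pivot_def field_simps)

lemma ramp_ge_0: "0 \<le> ramp s m x" and ramp_le_1: "ramp s m x \<le> 1"
  by (auto simp: ramp_def)

lemma ramp_eq_0_iff:
  assumes "0 < s"
  shows "ramp s m x = 0 \<longleftrightarrow> s * pivot m \<le> real m + pivot m - x"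
  using assms pivot_pos[of m] by (auto simp: ramp_def max_def min_def field_simps)

lemma ramp_eq_1_iff:
  assumes "0 < s"
  shows "ramp s m x = 1 \<longleftrightarrow> s * (1 - pivot m) \<le> x - real m - pivot m"
  using assms by (auto simp: ramp_def max_def min_def field_simps)

lemma ramp_eq_0:
  assumes "0 < s" "s \<le> 1" "x \<le> real m"
  shows "ramp s m x = 0"
proof -
  have "s * pivot m \<le> 1 * pivot m"
    using assms pivot_pos[of m] by (intro mult_right_mono) auto
  then show ?thesis using assms by (simp add: ramp_eq_0_iff)
qed

lemma ramp_eq_1:
  assumes "0 < s" "s \<le> 1" "1 \<le> m" "real m + 1 \<le> x"
  shows "ramp s m x = 1"
proof -
  have "s * (1 - pivot m) \<le> 1 * (1 - pivot m)"
    using assms pivot_less_1[of m] by (intro mult_right_mono) auto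
  then show ?thesis using assms by (simp add: ramp_eq_1_iff)
qed

lemma spread_ge_1: "1 \<le> spread p s x"
  by (simp add: spread_def sum_nonneg ramp_ge_0)

lemma spread_le:
  assumes "p \<ge> 1"
  shows "spread p s x \<le> real p"
proof -
  have "(\<Sum>m = 1..<p. ramp s m x) \<le> (\<Sum>m = 1..<p. 1)"
    by (intro sum_mono ramp_le_1)
  then show ?thesis using assms by (simp add: spread_def)
qed

lemma spread_1:
  assumes "1 \<le> x" "x \<le> real p"
  shows "spread p 1 x = x"
proof -
  \<comment> \<open>At \<open>s = 1\<close> the pivot cancels: each ramp clamps \<open>x - m\<close>
    to \<open>[0, 1]\<close>, and together they clamp \<open>x - 1\<close> to
    \<open>[0, p - 1]\<close>.\<close>
  have "(\<Sum>m = 1..<p. ramp 1 m x) = max 0 (min (real p - 1) (x - 1))" if "p \<ge> 1" for p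
    using that
  proof (induction p rule: nat_induct_at_least)
    case (Suc p)
    then show ?case by (auto simp: ramp_def max_def min_def)
  qed simp
  moreover have "p \<ge> 1" using assms by linarith
  ultimately show ?thesis using assms by (simp add: spread_def)
qed

text \<open>The pivots have decreasing fractional parts, so expanding away from them
  never shortens a distance that is at least one.\<close>

lemma ramp_Suc_ge:
  assumes "0 < s" "s \<le> 1" "a + 1 \<le> b"
  shows "ramp s m a \<le> ramp s (Suc m) b"
proof -
  \<comment> \<open>This product plus \<open>b - a - 1\<close> is \<open>s\<close> times the
    difference of the two unclamped ramps.\<close>
  have "0 \<le> (1 - s) * (pivot m - pivot (Suc m))"
    using assms pivot_Suc_less[of m] by (intro mult_nonneg_nonneg) auto
  then have "s * pivot m + (a - real m - pivot m)
      \<le> s * pivot (Suc m) + (b - real (Suc m) - pivot (Suc m))"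
    using assms by (simp add: algebra_simps)
  then have "(s * pivot m + (a - real m - pivot m)) / s
      \<le> (s * pivot (Suc m) + (b - real (Suc m) - pivot (Suc m))) / s"
    using assms by (intro divide_right_mono) auto
  then have "pivot m + (a - real m - pivot m) / s
      \<le> pivot (Suc m) + (b - real (Suc m) - pivot (Suc m)) / s"
    using assms by (simp add: add_divide_distrib)
  then show ?thesis unfolding ramp_def by linarith
qed

text \<open>Ramp \<open>m\<close> at \<open>a\<close> is compared with ramp \<open>m + 1\<close> at
  \<open>b\<close>. This leaves over the last ramp at \<open>a\<close>, which is 0 as
  \<open>a \<le> p - 1\<close>, and the first ramp at \<open>b\<close>, which is 1 as
  \<open>b \<ge> 2\<close>; the latter supplies the gap.\<close>

lemma spread_unit_gap:
  assumes "0 < s" "s \<le> 1" "1 \<le> a" "a + 1 \<le> b" "b \<le> real p"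
  shows "spread p s a + 1 \<le> spread p s b"
proof -
  have "2 \<le> p" using assms by linarith
  then obtain r where r: "p = Suc r" "1 \<le> r" by (cases p) auto
  have "ramp s r a = 0" using assms r by (intro ramp_eq_0) auto
  then have "spread p s a = 1 + (\<Sum>m = 1..<r. ramp s m a)"
    using r by (simp add: spread_def)
  moreover have "(\<Sum>m = 1..<r. ramp s m a) \<le> (\<Sum>m = 1..<r. ramp s (Suc m) b)"
    using assms by (intro sum_mono ramp_Suc_ge)
  moreover have "ramp s 1 b = 1" using assms by (intro ramp_eq_1) auto
  then have "spread p s b = 2 + (\<Sum>m = 1..<r. ramp s (Suc m) b)"
    using r sum.shift_bounds_Suc_ivl[of "\<lambda>m. ramp s m b" 1 r]
    by (simp add: spread_def sum.atLeast_Suc_lessThan del: sum.op_ivl_Suc)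
  ultimately show ?thesis by simp
qed

lemma spread_abs_gap:
  assumes "0 < s" "s \<le> 1" "1 \<le> a" "a \<le> real p" "1 \<le> b" "b \<le> real p" "1 \<le> \<bar>a - b\<bar>"
  shows "1 \<le> \<bar>spread p s a - spread p s b\<bar>"
proof (cases "a \<le> b")
  case True
  then show ?thesis using assms spread_unit_gap[of s a b p] by linarith
next
  case False
  then show ?thesis using assms spread_unit_gap[of s b a p] by linarith
qed

section \<open>Thresholds on one axis\<close>

text \<open>The bound on \<open>s\<close> says exactly that ramp \<open>m\<close> is 0 at
  \<open>a\<close> and 1 at \<open>b\<close>. It also puts \<open>m + pivot m\<close> strictly
  between \<open>a\<close> and \<open>b\<close>, so all later ramps vanish at \<open>a\<close> and
  all earlier ones equal 1 at \<open>b\<close>.\<close>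

lemma spread_clearance:
  assumes "0 < s" "s \<le> 1" "s \<le> clearance m a b" "1 \<le> m" "b \<le> real p"
  shows "m < p" "spread p s a \<le> real m" "real m + 1 \<le> spread p s b"
proof -
  note pv = pivot_pos[of m] pivot_less_1[OF \<open>1 \<le> m\<close>]
  have A: "s * pivot m \<le> real m + pivot m - a"
    and B: "s * (1 - pivot m) \<le> b - real m - pivot m"
    using assms(3) pv by (auto simp: clearance_def field_simps)
  have "0 < s * pivot m" "0 < s * (1 - pivot m)" using assms pv by auto
  then have ab: "a \<le> real m + 1" "real m < b" using A B pv by linarith+
  show mp: "m < p" using ab assms by linarith
  then have split: "{1..<p} = {1..<m} \<union> {m..<p}" using assms by auto
  have "ramp s j a = 0" if "j \<in> {m..<p}" for j
  proof (cases "j = m")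
    case True
    then show ?thesis using A assms by (simp add: ramp_eq_0_iff)
  next
    case False
    then show ?thesis using ab that assms by (intro ramp_eq_0) auto
  qed
  then have "(\<Sum>j = 1..<p. ramp s j a) = (\<Sum>j = 1..<m. ramp s j a)"
    unfolding split by (subst sum.union_disjoint) auto
  also have "\<dots> \<le> (\<Sum>j = 1..<m. 1)" by (intro sum_mono ramp_le_1)
  finally show "spread p s a \<le> real m" using assms by (simp add: spread_def)
  have "ramp s j b = 1" if "j \<in> {1..m}" for j
  proof (cases "j = m")
    case True
    then show ?thesis using B assms by (simp add: ramp_eq_1_iff)
  next
    case False
    then show ?thesis using ab that assms by (intro ramp_eq_1) auto
  qed
  then have "real m = (\<Sum>j = 1..m. ramp s j b)" by simp
  also have "\<dots> \<le> (\<Sum>j = 1..<p. ramp s j b)"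
    using mp by (intro sum_mono2) (auto simp: ramp_ge_0)
  finally show "real m + 1 \<le> spread p s b" by (simp add: spread_def)
qed

lemma axis_slack_spread:
  assumes "0 < s" "s \<le> 1" "s \<le> axis_slack p a b" "p \<ge> 1" "a \<le> real p" "b \<le> real p"
  shows "grid_separated p (spread p s a) (spread p s b)"
proof -
  have "\<exists>m\<in>{1..p}. s \<le> max (clearance m a b) (clearance m b a)"
    using assms by (auto simp: axis_slack_def Max_ge_iff)
  then obtain m where "1 \<le> m" "s \<le> clearance m a b \<or> s \<le> clearance m b a"
    by (auto simp: le_max_iff_disj)
  then show ?thesis
    using assms spread_clearance[of s m a b p] spread_clearance[of s m b a p]
    unfolding grid_separated_def by (metis atLeastLessThan_iff)
qed

lemma axis_slack_commute: "axis_slack p a b = axis_slack p b a"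
  by (simp add: axis_slack_def max.commute)

lemma axis_slack_ge_clearance:
  assumes "m \<in> {1..p}"
  shows "clearance m a b \<le> axis_slack p a b" "clearance m b a \<le> axis_slack p a b"
  using assms by (auto simp: axis_slack_def Max_ge_iff le_max_iff_disj)

lemma axis_slack_le_1: "p \<ge> 1 \<Longrightarrow> axis_slack p a b \<le> 1"
  by (simp add: axis_slack_def clearance_def)

text \<open>Consecutive pivots are less than one apart, hence one of them lies
  strictly between any two coordinates at distance at least one.\<close>

lemma axis_slack_pos_aux:
  assumes "1 \<le> a" "a + 1 \<le> b" "b \<le> real p"
  shows "0 < axis_slack p a b"
proof -
  \<comment> \<open>The first pivot point beyond \<open>a\<close>. Its index is not 0, because
    \<open>0 + pivot 0 = 1 \<le> a\<close>.\<close>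
  define m where "m = (LEAST m. a < real m + pivot m)"
  have "a < real p + pivot p" using assms pivot_pos[of p] by linarith
  then have m: "a < real m + pivot m" "m \<le> p"
    unfolding m_def by (auto intro: LeastI Least_le)
  have m1: "m \<ge> 1" using m assms by (cases m) (auto simp: pivot_def)
  have "real m + pivot m < b"
  proof (cases "m = 1")
    case True
    then show ?thesis using assms by (simp add: pivot_def)
  next
    case False
    then obtain j where j: "m = Suc j" using m1 by (cases m) auto
    then have "real j + pivot j \<le> a" using not_less_Least[of j "\<lambda>m. a < real m + pivot m"] m_def
      by simp
    then show ?thesis using j assms pivot_Suc_less[of j] by simp
  qed
  then have "0 < clearance m a b"
    using m m1 pivot_pos[of m] pivot_less_1[of m] by (simp add: clearance_def)
  then show ?thesis using axis_slack_ge_clearance(1)[of m p a b] m m1 by simp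
qed

lemma axis_slack_pos:
  assumes "1 \<le> a" "a \<le> real p" "1 \<le> b" "b \<le> real p" "1 \<le> \<bar>a - b\<bar>"
  shows "0 < axis_slack p a b"
proof (cases "a \<le> b")
  case True
  then show ?thesis using assms by (intro axis_slack_pos_aux) auto
next
  case False
  then show ?thesis using assms
    by (subst axis_slack_commute) (intro axis_slack_pos_aux, auto)
qed

text \<open>For a separating \<open>m\<close> both quotients in \<open>clearance\<close> are at
  least 1, so its cap at 1 is attained. This will keep the homotopy stationary on the
  complex.\<close>

lemma grid_separated_axis_slack:
  assumes "grid_separated p a b"
  shows "axis_slack p a b = 1"
proof -
  obtain m where m: "m \<in> {1..<p}"
    "a \<le> real m \<and> real m + 1 \<le> b \<or> b \<le> real m \<and> real m + 1 \<le> a"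
    using assms by (auto simp: grid_separated_def)
  have "clearance m a b = 1 \<or> clearance m b a = 1"
    using m pivot_pos[of m] pivot_less_1[of m] by (auto simp: clearance_def min_def field_simps)
  then have "1 \<le> axis_slack p a b"
    using axis_slack_ge_clearance[of m p, where a = a and b = b] m by auto
  then show ?thesis using axis_slack_le_1[of p a b] m by simp
qed

section \<open>Thresholds of configurations\<close>

lemma index_pairs_iff: "(k, l) \<in> index_pairs n \<longleftrightarrow> 1 \<le> k \<and> k < l \<and> l \<le> n"
  by (auto simp: index_pairs_def)

lemma finite_index_pairs: "finite (index_pairs n)"
  by (rule finite_subset[of _ "{1..n} \<times> {1..n}"]) (auto simp: index_pairs_def)

lemma slack_le_1: "slack n p q c \<le> 1"
  and slack_le: "(k, l) \<in> index_pairs n \<Longrightarrow> slack n p q c \<le> pair_slack p q (c k) (c l)"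
  by (auto simp: slack_def finite_index_pairs intro!: Min_le)

lemma conf_set_iff:
  "c \<in> conf_set n p q \<longleftrightarrow> c \<in> extensional {1..n} \<and>
     (\<forall>k\<in>{1..n}. 1 \<le> fst (c k) \<and> fst (c k) \<le> real p \<and> 1 \<le> snd (c k) \<and> snd (c k) \<le> real q) \<and>
     (\<forall>(k, l)\<in>index_pairs n. 1 \<le> \<bar>fst (c k) - fst (c l)\<bar> \<or> 1 \<le> \<bar>snd (c k) - snd (c l)\<bar>)"
  by (simp add: conf_set_def conf_ambient_def PiE_def Ball_def index_pairs_iff)

lemma slack_pos:
  assumes "c \<in> conf_set n p q"
  shows "0 < slack n p q c"
proof -
  have "0 < pair_slack p q (c k) (c l)" if "(k, l) \<in> index_pairs n" for k l
  proof -
    have "k \<in> {1..n}" "l \<in> {1..n}" using that by (auto simp: index_pairs_def)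
    then have "1 \<le> fst (c j) \<and> fst (c j) \<le> real p \<and> 1 \<le> snd (c j) \<and> snd (c j) \<le> real q"
      if "j \<in> {k, l}" for j
      using assms that by (auto simp: conf_set_iff)
    moreover have "1 \<le> \<bar>fst (c k) - fst (c l)\<bar> \<or> 1 \<le> \<bar>snd (c k) - snd (c l)\<bar>"
      using assms that unfolding conf_set_iff by blast
    ultimately show ?thesis
      unfolding pair_slack_def less_max_iff_disj by (meson axis_slack_pos insertCI)
  qed
  then show ?thesis by (auto simp: slack_def finite_index_pairs)
qed

section \<open>Pairwise description of the complex\<close>

text \<open>Both cells have integer endpoints, so when they are disjoint one ends at least a full
  unit before the other begins; its right endpoint serves as \<open>m\<close>.\<close>

lemma interval_cells_disjoint:
  assumes "I \<in> interval_cells p" "J \<in> interval_cells p" "I \<inter> J = {}" "a \<in> I" "b \<in> J"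
  shows "grid_separated p a b"
proof -
  have cell: "\<exists>i j. 1 \<le> i \<and> i \<le> j \<and> j \<le> p \<and> K = {real i..real j}"
    if "K \<in> interval_cells p" for K
    using that unfolding interval_cells_def
  proof (elim UnE CollectE exE conjE)
    fix i assume "K = {real i}" "1 \<le> i" "i \<le> p"
    then show ?thesis by (intro exI[of _ i]) auto
  next
    fix i assume "K = {real i..real (i + 1)}" "1 \<le> i" "i + 1 \<le> p"
    then show ?thesis by (intro exI[of _ i] exI[of _ "i + 1"]) auto
  qed
  obtain i j where I: "1 \<le> i" "i \<le> j" "j \<le> p" "I = {real i..real j}"
    using cell[OF assms(1)] by auto
  obtain i' j' where J: "1 \<le> i'" "i' \<le> j'" "j' \<le> p" "J = {real i'..real j'}"
    using cell[OF assms(2)] by auto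
  \<comment> \<open>If neither cell ended before the other began, both would contain the larger left
    endpoint.\<close>
  have "real (max i i') \<notin> I \<inter> J" using assms(3) by blast
  then have "j < i' \<or> j' < i" using I J by (auto simp: max_def split: if_splits)
  then show ?thesis
  proof
    assume "j < i'"
    then show ?thesis unfolding grid_separated_def
      using I J assms(4,5) by (intro bexI[of _ j]) auto
  next
    assume "j' < i"
    then show ?thesis unfolding grid_separated_def
      using I J assms(4,5) by (intro bexI[of _ j']) auto
  qed
qed

text \<open>This is the smallest cell containing \<open>x\<close>: a point if \<open>x\<close> is an
  integer, and otherwise a unit interval, which fits because then \<open>x < p\<close>.\<close>

lemma hull_cell:
  assumes "1 \<le> x" "x \<le> real p"
  shows "{of_int \<lfloor>x\<rfloor>..of_int \<lceil>x\<rceil>} \<in> interval_cells p"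
proof -
  define i where "i = nat \<lfloor>x\<rfloor>"
  have i: "of_int \<lfloor>x\<rfloor> = real i" "1 \<le> i" "i \<le> p" using assms by (auto simp: i_def) linarith+
  show ?thesis
  proof (cases "x = real i")
    case True
    then show ?thesis using i by (auto simp: interval_cells_def)
  next
    case False
    then have "\<lceil>x\<rceil> = int i + 1" using i(1) by (simp add: ceiling_eq_iff) linarith
    then have "of_int \<lceil>x\<rceil> = real (i + 1)" by simp
    moreover have "i + 1 \<le> p" using i assms False calculation by linarith
    ultimately show ?thesis using i by (auto simp: interval_cells_def)
  qed
qed

text \<open>Rounding up cannot cross the integer bound \<open>m\<close> from below, nor rounding
  down the bound \<open>m + 1\<close> from above.\<close>

lemma grid_separated_hull:
  fixes a b a' b' :: real
  assumes "grid_separated p a b"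
    and "a' \<in> {of_int \<lfloor>a\<rfloor>..of_int \<lceil>a\<rceil>}" "b' \<in> {of_int \<lfloor>b\<rfloor>..of_int \<lceil>b\<rceil>}"
  shows "1 \<le> \<bar>a' - b'\<bar>"
proof -
  have up: "x' \<le> real m" if "x \<le> real m" "x' \<le> of_int \<lceil>x\<rceil>" for x x' :: real and m
  proof -
    have "\<lceil>x\<rceil> \<le> int m" using that by (simp add: ceiling_le_iff)
    then show ?thesis using that by linarith
  qed
  have low: "real m + 1 \<le> x'" if "real m + 1 \<le> x" "of_int \<lfloor>x\<rfloor> \<le> x'" for x x' :: real and m
  proof -
    have "int m + 1 \<le> \<lfloor>x\<rfloor>" using that by (simp add: le_floor_iff)
    then show ?thesis using that by linarith
  qed
  obtain m where "a \<le> real m \<and> real m + 1 \<le> b \<or> b \<le> real m \<and> real m + 1 \<le> a"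
    using assms by (auto simp: grid_separated_def)
  then show ?thesis using up[of a m a'] up[of b m b'] low[of m a a'] low[of m b b'] assms(2,3)
    by auto
qed

text \<open>A cell inside the configuration space must have, for each pair of squares, disjoint
  factors in some coordinate, and points of disjoint factors are grid separated. Conversely, the
  smallest cell containing \<open>c\<close> inherits all separations of \<open>c\<close>.\<close>

lemma X_set_iff:
  "c \<in> X_set n p q \<longleftrightarrow> c \<in> conf_set n p q \<and>
     (\<forall>(k, l)\<in>index_pairs n.
        grid_separated p (fst (c k)) (fst (c l)) \<or> grid_separated q (snd (c k)) (snd (c l)))"
proof (intro iffI conjI)
  assume c: "c \<in> X_set n p q"
  then show "c \<in> conf_set n p q" using X_set_subset_conf_set by blast
  obtain I J where IJ: "\<forall>k\<in>{1..n}. I k \<in> interval_cells p \<and> J k \<in> interval_cells q"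
    and cIJ: "c \<in> (\<Pi>\<^sub>E k\<in>{1..n}. I k \<times> J k)"
    and sub: "(\<Pi>\<^sub>E k\<in>{1..n}. I k \<times> J k) \<subseteq> conf_set n p q"
    using c unfolding X_set_def X_cells_def grid_cells_def by blast
  show "\<forall>(k, l)\<in>index_pairs n.
        grid_separated p (fst (c k)) (fst (c l)) \<or> grid_separated q (snd (c k)) (snd (c l))"
  proof clarify
    fix k l assume kl: "(k, l) \<in> index_pairs n" and "\<not> grid_separated q (snd (c k)) (snd (c l))"
    then have k: "k \<in> {1..n}" and l: "l \<in> {1..n}" by (auto simp: index_pairs_def)
    have m: "c k \<in> I k \<times> J k" "c l \<in> I l \<times> J l" using PiE_mem[OF cIJ] k l by blast+
    have "J k \<inter> J l \<noteq> {}"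
      using \<open>\<not> grid_separated q _ _\<close> interval_cells_disjoint[of "J k" q "J l"] IJ k l m
      by (auto simp: mem_Times_iff)
    then obtain y where y: "y \<in> J k" "y \<in> J l" by blast
    show "grid_separated p (fst (c k)) (fst (c l))"
    proof (rule ccontr)
      assume "\<not> grid_separated p (fst (c k)) (fst (c l))"
      then have "I k \<inter> I l \<noteq> {}"
        using interval_cells_disjoint[of "I k" p "I l"] IJ k l m by (auto simp: mem_Times_iff)
      then obtain x where x: "x \<in> I k" "x \<in> I l" by blast
      \<comment> \<open>With overlap in both coordinates, the two squares could be put at the same
        position without leaving the cell.\<close>
      have "c(k := (x, y), l := (x, y)) \<in> (\<Pi>\<^sub>E k\<in>{1..n}. I k \<times> J k)"
        using cIJ k l x y by (auto simp: PiE_iff extensional_def)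
      then have "c(k := (x, y), l := (x, y)) \<in> conf_set n p q" using sub by blast
      then show False using kl unfolding conf_set_iff by (auto dest!: bspec[OF _ kl] simp: index_pairs_iff)
    qed
  qed
next
  assume c: "c \<in> conf_set n p q \<and>
     (\<forall>(k, l)\<in>index_pairs n.
        grid_separated p (fst (c k)) (fst (c l)) \<or> grid_separated q (snd (c k)) (snd (c l)))"
  define I where "I k = {real_of_int \<lfloor>fst (c k)\<rfloor>..of_int \<lceil>fst (c k)\<rceil>}" for k
  define J where "J k = {real_of_int \<lfloor>snd (c k)\<rfloor>..of_int \<lceil>snd (c k)\<rceil>}" for k
  define e where "e = (\<Pi>\<^sub>E k\<in>{1..n}. I k \<times> J k)"
  have IJ: "\<forall>k\<in>{1..n}. I k \<in> interval_cells p \<and> J k \<in> interval_cells q"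
    using c unfolding I_def J_def by (auto simp: conf_set_iff intro!: hull_cell)
  have "c \<in> e" using c by (auto simp: e_def I_def J_def PiE_iff conf_set_iff mem_Times_iff)
  moreover have "e \<in> grid_cells n p q" using IJ by (auto simp: grid_cells_def e_def)
  moreover have "e \<subseteq> conf_set n p q"
  proof
    fix d assume d: "d \<in> e"
    have dk: "fst (d k) \<in> I k" "snd (d k) \<in> J k" if "k \<in> {1..n}" for k
      using d that by (auto simp: e_def PiE_iff mem_Times_iff)
    have "I k \<subseteq> {1..real p}" "J k \<subseteq> {1..real q}" if "k \<in> {1..n}" for k
      using IJ that unfolding interval_cells_def by fastforce+
    then have "\<forall>k\<in>{1..n}. 1 \<le> fst (d k) \<and> fst (d k) \<le> real p \<and> 1 \<le> snd (d k) \<and> snd (d k) \<le> real q"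
      using dk by (meson atLeastAtMost_iff subsetD)
    moreover have "1 \<le> \<bar>fst (d k) - fst (d l)\<bar> \<or> 1 \<le> \<bar>snd (d k) - snd (d l)\<bar>"
      if kl: "(k, l) \<in> index_pairs n" for k l
    proof -
      have "k \<in> {1..n}" "l \<in> {1..n}" using kl by (auto simp: index_pairs_def)
      then show ?thesis using c kl dk[of k] dk[of l] unfolding I_def J_def
        by (blast intro: grid_separated_hull)
    qed
    ultimately show "d \<in> conf_set n p q"
      using d by (auto simp: conf_set_iff e_def PiE_def)
  qed
  ultimately show "c \<in> X_set n p q" by (auto simp: X_set_def X_cells_def)
qed

section \<open>Expanding whole configurations\<close>

lemma slack_X_set:
  assumes "c \<in> X_set n p q" "p \<ge> 1" "q \<ge> 1"
  shows "slack n p q c = 1"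
proof -
  have "pair_slack p q (c k) (c l) = 1" if "(k, l) \<in> index_pairs n" for k l
  proof -
    have "axis_slack p (fst (c k)) (fst (c l)) = 1 \<or> axis_slack q (snd (c k)) (snd (c l)) = 1"
      using assms that by (auto simp: X_set_iff intro: grid_separated_axis_slack)
    moreover have "axis_slack p (fst (c k)) (fst (c l)) \<le> 1" "axis_slack q (snd (c k)) (snd (c l)) \<le> 1"
      using assms by (simp_all add: axis_slack_le_1)
    ultimately show ?thesis by (auto simp: pair_slack_def)
  qed
  then have "insert 1 ((\<lambda>(k, l). pair_slack p q (c k) (c l)) ` index_pairs n) = {1}" by auto
  then show ?thesis by (simp only: slack_def) simp
qed

lemma spread_conf_in_conf_set:
  assumes "c \<in> conf_set n p q" "p \<ge> 1" "q \<ge> 1" "0 < s" "s \<le> 1"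
  shows "spread_conf n p q s c \<in> conf_set n p q"
proof -
  have "1 \<le> \<bar>spread p s (fst (c k)) - spread p s (fst (c l))\<bar> \<or>
      1 \<le> \<bar>spread q s (snd (c k)) - spread q s (snd (c l))\<bar>"
    if "(k, l) \<in> index_pairs n" for k l
  proof -
    have "k \<in> {1..n}" "l \<in> {1..n}" using that by (auto simp: index_pairs_def)
    then have "1 \<le> fst (c j) \<and> fst (c j) \<le> real p \<and> 1 \<le> snd (c j) \<and> snd (c j) \<le> real q"
      if "j \<in> {k, l}" for j
      using assms that by (auto simp: conf_set_iff)
    moreover have "1 \<le> \<bar>fst (c k) - fst (c l)\<bar> \<or> 1 \<le> \<bar>snd (c k) - snd (c l)\<bar>"
      using assms that unfolding conf_set_iff by blast
    ultimately show ?thesis using assms(4,5) by (meson spread_abs_gap insertCI)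
  qed
  then show ?thesis using assms
    by (auto simp: conf_set_iff spread_conf_def spread_ge_1 spread_le index_pairs_def)
qed

lemma spread_conf_1:
  assumes "c \<in> conf_set n p q"
  shows "spread_conf n p q 1 c = c"
  using assms by (auto simp: spread_conf_def conf_set_iff spread_1 extensional_def fun_eq_iff)

text \<open>A pair is separated for every positive \<open>s\<close> up to its own threshold, so the
  minimum of the thresholds separates all pairs simultaneously.\<close>

lemma spread_conf_slack_in_X_set:
  assumes "c \<in> conf_set n p q" "p \<ge> 1" "q \<ge> 1"
  shows "spread_conf n p q (slack n p q c) c \<in> X_set n p q"
proof -
  define s where "s = slack n p q c"
  have s: "0 < s" "s \<le> 1" using assms by (auto simp: s_def slack_pos slack_le_1)
  have "grid_separated p (spread p s (fst (c k))) (spread p s (fst (c l))) \<or>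
      grid_separated q (spread q s (snd (c k))) (spread q s (snd (c l)))"
    if kl: "(k, l) \<in> index_pairs n" for k l
  proof -
    have "k \<in> {1..n}" "l \<in> {1..n}" using kl by (auto simp: index_pairs_def)
    moreover have "s \<le> pair_slack p q (c k) (c l)" using slack_le[OF kl] by (simp add: s_def)
    ultimately show ?thesis using assms s axis_slack_spread
      by (auto simp: pair_slack_def le_max_iff_disj conf_set_iff)
  qed
  then show ?thesis
    unfolding X_set_iff s_def[symmetric] using spread_conf_in_conf_set[OF assms s]
    by (auto simp: spread_conf_def index_pairs_def)
qed

section \<open>Continuity of thresholds and expansion\<close>

lemma continuous_map_Max:
  fixes f :: "'i \<Rightarrow> 'a \<Rightarrow> real"
  assumes "finite A" "A \<noteq> {}" "\<And>i. i \<in> A \<Longrightarrow> continuous_map X euclidean (f i)"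
  shows "continuous_map X euclidean (\<lambda>x. Max ((\<lambda>i. f i x) ` A))"
  using assms
proof (induction A rule: finite_ne_induct)
  case (insert i A)
  then show ?case by (simp add: continuous_map_real_max)
qed simp

lemma continuous_map_Min:
  fixes f :: "'i \<Rightarrow> 'a \<Rightarrow> real"
  assumes "finite A" "A \<noteq> {}" "\<And>i. i \<in> A \<Longrightarrow> continuous_map X euclidean (f i)"
  shows "continuous_map X euclidean (\<lambda>x. Min ((\<lambda>i. f i x) ` A))"
  using assms
proof (induction A rule: finite_ne_induct)
  case (insert i A)
  then show ?case by (simp add: continuous_map_real_min)
qed simp

lemma continuous_map_axis_slack:
  assumes "p \<ge> 1" "continuous_map X euclidean f" "continuous_map X euclidean g"
  shows "continuous_map X euclidean (\<lambda>x. axis_slack p (f x) (g x))"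
  \<comment> \<open>Division by a constant becomes multiplication by one, which needs no
    nonvanishing condition.\<close>
  unfolding axis_slack_def clearance_def divide_inverse using assms
  by (intro continuous_map_Max continuous_map_real_max continuous_map_real_min
      continuous_map_real_mult continuous_map_diff continuous_map_add continuous_map_const[THEN iffD2]) auto

lemma continuous_map_slack:
  assumes "p \<ge> 1" "q \<ge> 1"
    and "\<And>k. k \<in> {1..n} \<Longrightarrow> continuous_map X euclidean (\<lambda>x. fst (g x k))"
    and "\<And>k. k \<in> {1..n} \<Longrightarrow> continuous_map X euclidean (\<lambda>x. snd (g x k))"
  shows "continuous_map X euclidean (\<lambda>x. slack n p q (g x))"
proof (cases "index_pairs n = {}")
  case False
  have "slack n p q (g x) =
      min 1 (Min ((\<lambda>(k, l). pair_slack p q (g x k) (g x l)) ` index_pairs n))" for x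
    using False by (simp add: slack_def finite_index_pairs)
  moreover have "continuous_map X euclidean
      (\<lambda>x. Min ((\<lambda>i. case i of (k, l) \<Rightarrow> pair_slack p q (g x k) (g x l)) ` index_pairs n))"
  proof (rule continuous_map_Min)
    fix i assume i: "i \<in> index_pairs n"
    then obtain k l where kl: "i = (k, l)" "k \<in> {1..n}" "l \<in> {1..n}"
      by (auto simp: index_pairs_def)
    show "continuous_map X euclidean (\<lambda>x. case i of (k, l) \<Rightarrow> pair_slack p q (g x k) (g x l))"
      using kl assms unfolding pair_slack_def
      by (auto intro!: continuous_map_real_max continuous_map_axis_slack)
  qed (use False finite_index_pairs in auto)
  ultimately show ?thesis by (simp add: continuous_map_real_min)
qed (simp add: slack_def)

text \<open>The parameter varies with the point too, because the final value of \<open>s\<close>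
  depends on the configuration.\<close>

lemma continuous_map_spread:
  assumes "continuous_map X euclidean f" "continuous_map X euclidean s"
    and "\<And>x. x \<in> topspace X \<Longrightarrow> s x \<noteq> 0"
  shows "continuous_map X euclidean (\<lambda>x. spread p (s x) (f x))"
  unfolding spread_def ramp_def using assms
  by (intro continuous_map_sum continuous_map_real_max continuous_map_real_min
      continuous_map_real_divide continuous_map_diff continuous_map_add
      continuous_map_const[THEN iffD2]) auto

section \<open>The homotopy and its retraction\<close>

theorem theorem3p5:
  fixes n p q :: nat
  assumes "p \<ge> 1" and "q \<ge> 1" and "n \<le> p * q"
  shows "X_set n p q deformation_retract_of_space conf_space n p q"
proof -
  let ?C = "conf_space n p q" and ?P = "prod_topology (top_of_set {0..1::real}) (conf_space n p q)"
  \<comment> \<open>The parameter runs linearly from 1, where the expansion is the identity, to the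
    slack, where the configuration has reached the complex.\<close>
  define s where "s = (\<lambda>(t :: real, c). 1 - t + t * slack n p q c)"
  define h where "h = (\<lambda>u. spread_conf n p q (s u) (snd u))"
  define r where "r = (\<lambda>c. spread_conf n p q (slack n p q c) c)"
  have s_bounds: "0 < s (t, c) \<and> s (t, c) \<le> 1" if "t \<in> {0..1}" "c \<in> conf_set n p q" for t c
  proof -
    \<comment> \<open>Since \<open>s (t, c)\<close> is \<open>1 - t * (1 - slack n p q c)\<close>,
      it stays between the positive slack and 1.\<close>
    have "t * (1 - slack n p q c) \<le> 1 * (1 - slack n p q c)"
      using that slack_le_1[of n p q c] by (intro mult_right_mono) auto
    moreover have "0 \<le> t * (1 - slack n p q c)"
      using that slack_le_1[of n p q c] by (intro mult_nonneg_nonneg) auto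
    ultimately show ?thesis using slack_pos[OF that(2)] by (simp add: s_def algebra_simps)
  qed
  have coord: "continuous_map ?P euclidean (\<lambda>u. snd u k)" if "k \<in> {1..n}" for k
  proof -
    have "continuous_map ?C euclidean (\<lambda>c. c k)"
      unfolding conf_space_def conf_ambient_def
      using that by (intro continuous_map_from_subtopology continuous_map_product_projection)
    then show ?thesis
      using continuous_map_compose[OF continuous_map_snd] by (fastforce simp: o_def)
  qed
  have coord_fst: "continuous_map ?P euclidean (\<lambda>u. fst (snd u k))"
    and coord_snd: "continuous_map ?P euclidean (\<lambda>u. snd (snd u k))" if "k \<in> {1..n}" for k
    using continuous_map_compose[OF coord[OF that], of euclidean fst]
      continuous_map_compose[OF coord[OF that], of euclidean snd]
    by (auto simp: o_def continuous_on_fst continuous_on_snd)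
  have time: "continuous_map ?P euclidean fst"
    using continuous_map_fst continuous_map_into_fulltopology by blast
  have cont_s: "continuous_map ?P euclidean s"
    unfolding s_def case_prod_unfold
    by (intro continuous_map_add continuous_map_diff continuous_map_real_mult time
        continuous_map_slack assms coord_fst coord_snd continuous_map_const[THEN iffD2]) auto
  have s_nz: "s u \<noteq> 0" if "u \<in> topspace ?P" for u
    using that s_bounds[of "fst u" "snd u"] by (auto simp: topspace_conf_space)
  have h_in: "h u \<in> conf_set n p q" if "u \<in> topspace ?P" for u
    using that s_bounds[of "fst u" "snd u"] assms unfolding h_def
    by (intro spread_conf_in_conf_set) (auto simp: topspace_conf_space)
  have "continuous_map ?P (conf_ambient n) h"
    unfolding conf_ambient_def continuous_map_componentwise
  proof (intro conjI ballI)
    show "h ` topspace ?P \<subseteq> extensional {1..n}"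
      by (auto simp: h_def spread_conf_def)
    fix k assume k: "k \<in> {1..n}"
    have "continuous_map ?P (prod_topology euclidean euclidean)
        (\<lambda>u. (spread p (s u) (fst (snd u k)), spread q (s u) (snd (snd u k))))"
      using k s_nz
      by (intro continuous_map_pairedI continuous_map_spread cont_s coord_fst coord_snd) auto
    then show "continuous_map ?P euclidean (\<lambda>u. h u k)"
      using k by (simp add: h_def spread_conf_def)
  qed
  then have cont_h: "continuous_map ?P ?C h"
    using h_in by (auto simp: conf_space_def continuous_map_in_subtopology)
  have h1: "h (1, c) = r c" for c by (simp add: h_def s_def r_def)
  have h0: "h (0, c) = c" if "c \<in> conf_set n p q" for c
    using that by (simp add: h_def s_def spread_conf_1)
  \<comment> \<open>On the complex the slack is 1, so the parameter is 1 for every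
    \<open>t\<close>.\<close>
  have h_fix: "h (t, c) = c" if "c \<in> X_set n p q" for t c
    using that assms X_set_subset_conf_set[of n p q]
    by (auto simp: h_def s_def slack_X_set spread_conf_1)
  have hom: "homotopic_with (\<lambda>f. \<forall>a\<in>X_set n p q. f a = a) ?C ?C id r"
  proof (subst homotopic_with)
    show "\<exists>h. continuous_map ?P ?C h \<and> (\<forall>x\<in>topspace ?C. h (0, x) = id x) \<and>
        (\<forall>x\<in>topspace ?C. h (1, x) = r x) \<and> (\<forall>t\<in>{0..1}. \<forall>a\<in>X_set n p q. h (t, a) = a)"
      using cont_h h0 h1 h_fix by (intro exI[of _ h]) (auto simp: topspace_conf_space)
  \<comment> \<open>What remains is that fixing the complex depends only on the values of a map on
    the configuration space.\<close>
  qed (use X_set_subset_conf_set in \<open>force simp: topspace_conf_space\<close>)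
  \<comment> \<open>As the end of the homotopy \<open>r\<close> is continuous, so only its image has
    to be located.\<close>
  moreover have "continuous_map ?C (subtopology ?C (X_set n p q)) r"
    using homotopic_with_imp_continuous_maps[OF hom] assms
    by (auto simp: continuous_map_in_subtopology topspace_conf_space r_def
        intro: spread_conf_slack_in_X_set)
  moreover have "r a = a" if "a \<in> X_set n p q" for a
    using h_fix[OF that, of 1] by (simp add: h1)
  ultimately show ?thesis
    unfolding deformation_retract_of_space_def
    using X_set_subset_conf_set by (auto simp: topspace_conf_space)
qed

end
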